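(* Let $A$ be the adjacency matrix of a connected undirected regular network on $N\ge2$ nodes with degree $d$, and consider $$F_i(\boldsymbol{x};\alpha)=f(x_i;\alpha)+D\sum_{j=1}^NA_{ij}G(x_i,x_j),\qquad i=1,\dots,N,$$ with homogeneous noise $B=\sigma I$. Let $x^*(\alpha)$ be a branch of solutions of $f(x^*(\alpha);\alpha)+Dd\,G(x^*(\alpha),x^*(\alpha))=0$. Then $\boldsymbol{x}^*(\alpha)=x^*(\alpha)\boldsymbol{1}$ is a uniform equilibrium branch. Suppose that this branch is asymptotically stable for $\alpha<\alpha_{\mathrm c}$ and loses stability as $\alpha\to\alpha_{\mathrm c}^-$, and that $D\,\partial_2G(x^*(\alpha),x^*(\alpha))>0$ near $\alpha_{\mathrm c}$, with $D\,\partial_2G(x^*(\alpha),x^*(\alpha))\to\omega_{\mathrm c}>0$. Then $S(\alpha)=\operatorname{Var}(\boldsymbol{x}^*(\alpha))=0$, the critical eigenspace is $\operatorname{span}\{\boldsymbol{1}\}$, and the normalized critical right eigenvector may be chosen as $\boldsymbol{v}=\boldsymbol{1}/\sqrt N$ throughout this branch. Consequently $\rho=(\boldsymbol{1}^\top\boldsymbol{v})^2/N=1$ and $\boldsymbol{v}_{\mathrm c}=\lim_{\alpha\to\alpha_{\mathrm c}^-}\boldsymbol{v}=\boldsymbol{1}/\sqrt N$ under this orientation. Let $\mu_1=d>\mu_2\ge\cdots\ge\mu_N$ be the eigenvalues of $A$, and let $\lambda_k$ denote the corresponding eigenvalues of the stability matrix $M$. Then $$\mathbb{E}[V]=\frac{\sigma^2}{2(N-1)}\sum_{k=2}^N\frac1{\lambda_k},$$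 and moreover, as $\alpha\to\alpha_{\mathrm c}^-$, $$\mathbb{E}[V]\longrightarrow\frac{\sigma^2}{2\omega_{\mathrm c}(N-1)}\sum_{k=2}^N\frac1{\mu_1-\mu_k}<\infty.$$
   Context: The system is the SDE $\mathrm d\boldsymbol{x}=F(\boldsymbol{x};\alpha)\,\mathrm dt+B\,\mathrm d\boldsymbol{W}$ in $\mathbb{R}^N$, with $\boldsymbol{W}$ a standard Wiener process and $f,G$ sufficiently smooth; $\partial_2G$ is the partial derivative of $G(u_1,u_2)$ in its second argument; $D$ is the coupling strength. The stability matrix is $M(\alpha)=-\frac{\partial F}{\partial\boldsymbol{x}}\big|_{\boldsymbol{x}=\boldsymbol{x}^*(\alpha)}$; asymptotic stability means that all eigenvalues of $M$ have positive real parts, and "loses stability as $\alpha\to\alpha_{\mathrm c}^-$" means that the smallest (real) eigenvalue of $M(\alpha)$ tends to $0$. The critical eigenspace / critical right eigenvector is the eigenspace / a unit right eigenvector of $M(\alpha)$ for its eigenvalue of smallest real part. "Corresponding eigenvalues" means: $M$ and $A$ share eigenvectors, and $\lambda_k$ is the eigenvalue of $M$ on the eigenvector of $A$ with eigenvalue $\mu_k$. The observed snapshot (linearized model) is $\boldsymbol{x}=\boldsymbol{x}^*(\alpha)+\boldsymbol{z}$ with $\boldsymbol{z}\sim\mathcal{N}(\boldsymbol{0},C(\alpha))$, where $C$ solves $MC+CM^\top=BB^\top$, and $V=\operatorname{Var}(\boldsymbol{x})$, where $\operatorname{Var}(\boldsymbol{u})=\frac1{N-1}\sum_i(u_i-\bar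 u)^2$, $\bar u=N^{-1}\sum_iu_i$. $\boldsymbol{1}$ is the all-ones vector.
   Formalization: The claims on the critical eigenspace, critical eigenvector and ρ=1 are made at those points of the branch where D∂₂G(x*,x* )>0 (in particular near α_c), not at every α<α_c; where D∂₂G≤0 the critical eigenspace is not span{1}. *)

theory Defs
  imports "HOL-Probability.Probability"
begin

text \<open>
  Networks are given by an edge relation on a finite type of nodes, so that the number of
  nodes is \<open>N = CARD('n)\<close> and states are vectors in \<open>real ^ 'n\<close>.
\<close>

definition connected_regular_graph :: "('n::finite \<Rightarrow> 'n \<Rightarrow> bool) \<Rightarrow> nat \<Rightarrow> bool" where
  "connected_regular_graph E d \<longleftrightarrow>
     symp E \<and> irreflp E \<and> (\<forall>i. card {j. E i j} = d) \<and> (\<forall>i j. E\<^sup>*\<^sup>* i j)"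

definition adjacency_matrix :: "('n::finite \<Rightarrow> 'n \<Rightarrow> bool) \<Rightarrow> real^'n^'n" where
  "adjacency_matrix E = (\<chi> i j. if E i j then 1 else 0)"

definition network_field ::
  "(real \<Rightarrow> real \<Rightarrow> real) \<Rightarrow> (real \<Rightarrow> real \<Rightarrow> real) \<Rightarrow> real \<Rightarrow> real^'n^'n \<Rightarrow>
     real^'n \<Rightarrow> real \<Rightarrow> real^'n::finite" where
  "network_field f G D A x \<alpha> =
     (\<chi> i. f (x $ i) \<alpha> + D * (\<Sum>j\<in>UNIV. A $ i $ j * G (x $ i) (x $ j)))"

definition stability_matrix ::
  "(real^'n \<Rightarrow> real \<Rightarrow> real^'n) \<Rightarrow> (real \<Rightarrow> real^'n) \<Rightarrow> real \<Rightarrow> real^'n^'n::finite" where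
  "stability_matrix F xs \<alpha> = - jacobian (\<lambda>x. F x \<alpha>) (at (xs \<alpha>))"

text \<open>Eigenvalues of a real square matrix are taken over the complex numbers.\<close>

definition eigenvalues :: "real^'n^'n \<Rightarrow> complex set" where
  "eigenvalues M =
     {l. \<exists>v::complex^'n::finite. v \<noteq> 0 \<and> (\<chi> i j. complex_of_real (M $ i $ j)) *v v = l *s v}"

definition asymptotically_stable :: "real^'n^'n::finite \<Rightarrow> bool" where
  "asymptotically_stable M \<longleftrightarrow> (\<forall>l\<in>eigenvalues M. 0 < Re l)"

text \<open>
  The smallest real part of an eigenvalue. When the eigenvalue of smallest real part is real,
  as for symmetric \<open>M\<close>, this number is that eigenvalue.
\<close>

definition critical_eigenvalue :: "real^'n^'n::finite \<Rightarrow> real" where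
  "critical_eigenvalue M = Min (Re ` eigenvalues M)"

definition critical_eigenspace :: "real^'n^'n::finite \<Rightarrow> (real^'n) set" where
  "critical_eigenspace M = {v. M *v v = critical_eigenvalue M *\<^sub>R v}"

definition critical_unit_eigenvector :: "real^'n^'n::finite \<Rightarrow> real^'n \<Rightarrow> bool" where
  "critical_unit_eigenvector M v \<longleftrightarrow> v \<in> critical_eigenspace M \<and> norm v = 1"

text \<open>
  \<open>\<mu> 1 \<ge> \<dots> \<ge> \<mu> N\<close> are the eigenvalues of \<open>A\<close>, all real, listed with algebraic multiplicity:
  they are the roots of the characteristic polynomial. Values of \<open>\<mu>\<close> outside \<open>{1..N}\<close> are
  irrelevant.
\<close>

definition ordered_eigenvalues :: "real^'n^'n::finite \<Rightarrow> (nat \<Rightarrow> real) \<Rightarrow> bool" where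
  "ordered_eigenvalues A \<mu> \<longleftrightarrow>
     (\<forall>t::real. det (mat t - A) = (\<Prod>k=1..CARD('n). t - \<mu> k)) \<and>
     (\<forall>k\<in>{1..CARD('n)}. \<forall>l\<in>{1..CARD('n)}. k \<le> l \<longrightarrow> \<mu> l \<le> \<mu> k)"

text \<open>
  \<open>m\<close> is an eigenvalue of \<open>A\<close>, and each eigenvector of \<open>A\<close> for \<open>m\<close> is an eigenvector of \<open>M\<close>
  for \<open>l\<close>. Since eigenvectors for \<open>m\<close> exist, \<open>l\<close> is uniquely determined by \<open>A\<close>, \<open>M\<close>, \<open>m\<close>.
\<close>

definition corresponding_eigenvalue ::
  "real^'n^'n::finite \<Rightarrow> real^'n^'n \<Rightarrow> real \<Rightarrow> real \<Rightarrow> bool" where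
  "corresponding_eigenvalue A M m l \<longleftrightarrow>
     (\<exists>u. u \<noteq> 0 \<and> A *v u = m *\<^sub>R u) \<and> (\<forall>u. A *v u = m *\<^sub>R u \<longrightarrow> M *v u = l *\<^sub>R u)"

definition mean_entry :: "real^'n::finite \<Rightarrow> real" where
  "mean_entry u = (\<Sum>i\<in>UNIV. u $ i) / real CARD('n)"

definition spatial_var :: "real^'n::finite \<Rightarrow> real" where
  "spatial_var u = (\<Sum>i\<in>UNIV. (u $ i - mean_entry u)\<^sup>2) / (real CARD('n) - 1)"

definition \<rho> :: "real^'n::finite \<Rightarrow> real" where
  "\<rho> v = (1 \<bullet> v)\<^sup>2 / real CARD('n)"

text \<open>Normal law with mean \<open>m\<close> and variance \<open>s \<ge> 0\<close>; it is a point mass when \<open>s = 0\<close>.\<close>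

definition normal_law :: "real \<Rightarrow> real \<Rightarrow> real measure" where
  "normal_law m s =
     (if s = 0 then return borel m
      else density lborel (\<lambda>t. ennreal (normal_density m (sqrt s) t)))"

text \<open>
  The random vector \<open>z\<close> has law \<open>\<N>(m, C)\<close>, possibly degenerate: \<open>C\<close> is symmetric positive
  semidefinite, and each linear functional \<open>u \<bullet> z\<close> is normal with mean \<open>u \<bullet> m\<close> and variance
  \<open>u \<bullet> C u\<close>.
\<close>

definition multivariate_normal ::
  "'w measure \<Rightarrow> ('w \<Rightarrow> real^'n::finite) \<Rightarrow> real^'n \<Rightarrow> real^'n^'n \<Rightarrow> bool" where
  "multivariate_normal P z m C \<longleftrightarrow>
     transpose C = C \<and> (\<forall>u. 0 \<le> u \<bullet> (C *v u)) \<and>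
     z \<in> borel_measurable P \<and>
     (\<forall>u. distr P borel (\<lambda>w. u \<bullet> z w) = normal_law (u \<bullet> m) (u \<bullet> (C *v u)))"

end

theory Submission
  imports Defs "HOL-Combinatorics.Permutations"
begin

text \<open>
  By the chain rule and regularity of the network, \<open>M = c I - \<omega> A\<close> for a scalar \<open>c\<close>, so \<open>M\<close> is
  symmetric and an orthonormal eigenbasis \<open>e\<^sub>1, \<dots>, e\<^sub>N\<close> of \<open>A\<close> diagonalises \<open>M\<close>, with
  \<open>\<lambda>\<^sub>k = c - \<omega> \<mu>\<^sub>k\<close>. The identity
  \<open>\<Sum>\<^sub>i\<^sub>j A\<^sub>i\<^sub>j (v\<^sub>i - v\<^sub>j)\<^sup>2 = 2 (d |v|\<^sup>2 - v \<bullet> A v)\<close> shows that no eigenvalue of \<open>A\<close> exceeds \<open>d\<close> and,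
  by connectedness, that \<open>d\<close> has eigenspace \<open>span {1}\<close>; hence \<open>e\<^sub>1\<close> is the critical direction.
  The spatial variance of \<open>z\<close> is \<open>\<Sum>\<^sub>k\<^sub>\<ge>\<^sub>2 (e\<^sub>k \<bullet> z)\<^sup>2 / (N - 1)\<close>, and testing the Lyapunov equation
  against \<open>e\<^sub>k\<close> gives \<open>2 \<lambda>\<^sub>k E[(e\<^sub>k \<bullet> z)\<^sup>2] = \<sigma>\<^sup>2\<close>. Finally
  \<open>\<lambda>\<^sub>k = \<lambda>\<^sub>1 + \<omega> (\<mu>\<^sub>1 - \<mu>\<^sub>k)\<close>, where \<open>\<lambda>\<^sub>1 \<rightarrow> 0\<close> and \<open>\<omega> \<rightarrow> \<omega>\<^sub>c\<close>.
\<close>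

subsection \<open>Symmetric matrices\<close>

text \<open>Near 0 the linear term dominates, so a nonzero \<open>b\<close> would force a negative
  value at some small \<open>t\<close> of opposite sign. This serves as the first-order condition at
  a maximiser.\<close>

lemma linear_coeff_eq_0_if_quadratic_nonneg:
  fixes b c :: real
  assumes "\<And>t. 0 \<le> t * b + t\<^sup>2 * c"
  shows "b = 0"
proof (rule ccontr)
  assume b: "b \<noteq> 0"
  \<comment> \<open>This choice gives
    \<open>b + t * \<bar>c\<bar> = b / (\<bar>c\<bar> + 1)\<close>; the summand 1 keeps the
    denominator positive when \<open>c = 0\<close>.\<close>
  define t where "t = - b / (\<bar>c\<bar> + 1)"
  have "t * b + t\<^sup>2 * c \<le> t * b + t\<^sup>2 * \<bar>c\<bar>"
    by (intro add_left_mono mult_left_mono) auto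
  also have "\<dots> = t * (b + t * \<bar>c\<bar>)"
    by (simp add: algebra_simps power2_eq_square)
  also have "b + t * \<bar>c\<bar> = b / (\<bar>c\<bar> + 1)"
    unfolding t_def by (simp add: field_simps)
  also have "t * (b / (\<bar>c\<bar> + 1)) = - ((b / (\<bar>c\<bar> + 1))\<^sup>2)"
    unfolding t_def by (simp add: power2_eq_square)
  also have "\<dots> < 0"
    using b by (simp add: add_nonneg_eq_0_iff)
  finally show False
    using assms[of t] by linarith
qed

text \<open>A maximiser of the Rayleigh quotient on the unit sphere of \<open>S\<close> is an eigenvector.\<close>

lemma selfadjoint_eigenvector_exists:
  fixes f :: "'a::euclidean_space \<Rightarrow> 'a"
  assumes f: "linear f" and adj: "\<And>x y. f x \<bullet> y = x \<bullet> f y"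
    and S: "subspace S" "f ` S \<subseteq> S" "S \<noteq> {0}"
  obtains e l where "e \<in> S" "norm e = 1" "f e = l *\<^sub>R e"
proof -
  have cont: "continuous_on X f" for X
    using f by (simp add: linear_continuous_on linear_conv_bounded_linear)
  let ?K = "sphere 0 1 \<inter> S"
  obtain a where a: "a \<in> S" "a \<noteq> 0"
    using S subspace_0 by blast
  then have "a /\<^sub>R norm a \<in> ?K"
    using S by (auto simp: subspace_scale)
  moreover have "compact ?K"
    using S by (intro compact_Int_closed closed_subspace) auto
  ultimately obtain e where e: "e \<in> ?K" "\<And>y. y \<in> ?K \<Longrightarrow> y \<bullet> f y \<le> e \<bullet> f e"
    using continuous_attains_sup[of ?K "\<lambda>x. x \<bullet> f x", OF _ _ continuous_on_inner[OF continuous_on_id cont]]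
    by blast
  define l where "l = e \<bullet> f e"
  \<comment> \<open>Both sides are homogeneous of degree 2, so the maximum over unit vectors bounds
    the form on all of \<open>S\<close>.\<close>
  have le: "y \<bullet> f y \<le> l * (y \<bullet> y)" if "y \<in> S" for y
  proof (cases "y = 0")
    case False
    have "(y /\<^sub>R norm y) \<bullet> f (y /\<^sub>R norm y) \<le> l"
      unfolding l_def using that False S by (intro e) (auto simp: subspace_scale)
    then show ?thesis
      using False f by (simp add: linear_cmul field_simps power2_norm_eq_inner[symmetric] power2_eq_square)
  qed (use f in \<open>simp add: linear_0\<close>)
  have ee: "e \<bullet> e = 1" "e \<in> S"
    using e by (auto simp: norm_eq_1)
  have orth: "y \<bullet> (l *\<^sub>R e - f e) = 0" if y: "y \<in> S" for y
  proof -
    \<comment> \<open>Insert \<open>e + t *\<^sub>R y\<close> into \<open>le\<close>: the gap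
      vanishes at \<open>t = 0\<close>, and its linear coefficient is twice the pairing of
      \<open>y\<close> with the residual \<open>l *\<^sub>R e - f e\<close>.\<close>
    have "0 \<le> t * (2 * (y \<bullet> (l *\<^sub>R e - f e))) + t\<^sup>2 * (l * (y \<bullet> y) - y \<bullet> f y)" for t
    proof -
      have "e + t *\<^sub>R y \<in> S"
        using S ee y by (simp add: subspace_add subspace_scale)
      from le[OF this] show ?thesis
        using ee adj[of y e] adj[of e y] f
        by (simp add: linear_add linear_cmul l_def algebra_simps inner_commute power2_eq_square)
    qed
    then show ?thesis
      using linear_coeff_eq_0_if_quadratic_nonneg by fastforce
  qed
  \<comment> \<open>The residual lies in \<open>S\<close> and is orthogonal to \<open>S\<close>,
    hence to itself.\<close>
  have "l *\<^sub>R e - f e \<in> S"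
    using S ee by (auto intro: subspace_diff subspace_scale)
  then have "f e = l *\<^sub>R e"
    using orth by fastforce
  with e that show ?thesis
    by auto
qed

text \<open>Induction on the dimension: split off a unit eigenvector \<open>e\<close>; by
  self-adjointness its orthogonal complement within \<open>S\<close> is again invariant.\<close>

lemma selfadjoint_orthonormal_eigenbasis:
  fixes f :: "'a::euclidean_space \<Rightarrow> 'a"
  assumes f: "linear f" and adj: "\<And>x y. f x \<bullet> y = x \<bullet> f y"
  shows "subspace S \<Longrightarrow> f ` S \<subseteq> S \<Longrightarrow>
    \<exists>X\<subseteq>S. pairwise orthogonal X \<and> (\<forall>e\<in>X. norm e = 1 \<and> (\<exists>l. f e = l *\<^sub>R e)) \<and> span X = S"
proof (induction "dim S" arbitrary: S rule: less_induct)
  case less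
  show ?case
  proof (cases "S = {0}")
    case True
    then show ?thesis
      by (intro exI[of _ "{}"]) auto
  next
    case False
    obtain e l where e: "e \<in> S" "norm e = 1" "f e = l *\<^sub>R e"
      using selfadjoint_eigenvector_exists[OF f adj less.prems False] by metis
    define T where "T = {x \<in> S. e \<bullet> x = 0}"
    have T: "subspace T"
      using less.prems unfolding T_def
      by (auto simp: subspace_def inner_add_right)
    have "f ` T \<subseteq> T"
      using less.prems adj[of e] e by (auto simp: T_def) (metis inner_scaleR_left mult_zero_right)
    moreover have "dim T < dim S"
    proof (rule dim_psubset)
      have "T \<subseteq> S" "e \<notin> T"
        using e by (auto simp: T_def norm_eq_1)
      then show "span T \<subset> span S"
        using T less.prems e span_eq_iff by (metis psubsetI)
    qed
    ultimately obtain X where X: "X \<subseteq> T" "pairwise orthogonal X"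
      "\<forall>e\<in>X. norm e = 1 \<and> (\<exists>l. f e = l *\<^sub>R e)" "span X = T"
      using less.hyps T by meson
    have "pairwise orthogonal (insert e X)"
      using X by (auto simp: pairwise_insert T_def orthogonal_def inner_commute)
    moreover have "span (insert e X) = S"
    proof (intro subset_antisym subsetI)
      show "x \<in> S" if "x \<in> span (insert e X)" for x
        using that X e less.prems(1) span_minimal[of "insert e X" S] by (auto simp: T_def)
      show "x \<in> span (insert e X)" if x: "x \<in> S" for x
      proof -
        have "x - (e \<bullet> x) *\<^sub>R e \<in> T"
          using x e less.prems by (auto simp: T_def subspace_diff subspace_scale norm_eq_1 inner_diff_right)
        with X show ?thesis
          unfolding span_insert by auto
      qed
    qed
    ultimately show ?thesis
      using X e by (intro exI[of _ "insert e X"]) (auto simp: T_def)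
  qed
qed

text \<open>Indexing by nodes makes the eigenvectors the columns of a square matrix of the same type
  as \<open>A\<close>. The eigenvalues carry no order here; the decreasing order enters later
  through a bijection.\<close>

definition orthonormal_eigenbasis ::
  "real^'n^'n \<Rightarrow> ('n \<Rightarrow> real^'n) \<Rightarrow> ('n::finite \<Rightarrow> real) \<Rightarrow> bool" where
  "orthonormal_eigenbasis A e \<nu> \<longleftrightarrow>
     (\<forall>i j. e i \<bullet> e j = (if i = j then 1 else 0)) \<and> (\<forall>i. A *v e i = \<nu> i *\<^sub>R e i)"

lemma orthonormal_eigenbasisD:
  assumes "orthonormal_eigenbasis A e \<nu>"
  shows "e i \<bullet> e j = (if i = j then 1 else 0)" "A *v e i = \<nu> i *\<^sub>R e i"
  using assms unfolding orthonormal_eigenbasis_def by auto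

lemma symmetric_matrix_eigenbasis:
  fixes A :: "real^'n^'n::finite"
  assumes "transpose A = A"
  obtains e \<nu> where "orthonormal_eigenbasis A e \<nu>"
proof -
  have "(A *v x) \<bullet> y = x \<bullet> (A *v y)" for x y
    using dot_lmul_matrix[of x A y] assms by (metis transpose_matrix_vector)
  then obtain X where X: "pairwise orthogonal X"
    "\<forall>e\<in>X. norm e = 1 \<and> (\<exists>l. A *v e = l *\<^sub>R e)" "span X = UNIV"
    using selfadjoint_orthonormal_eigenbasis[of "(*v) A" UNIV] by auto
  then have "independent X"
    by (intro pairwise_orthogonal_independent) auto
  then have "card X = CARD('n)" "finite X"
    using X dim_span[of X] by (auto simp: dim_eq_card_independent independent_imp_finite)
  then obtain e where e: "bij_betw e (UNIV::'n set) X"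
    by (metis finite_same_card_bij finite_class.finite_UNIV)
  obtain l where l: "\<And>x. x \<in> X \<Longrightarrow> A *v x = l x *\<^sub>R x"
    using X by metis
  have "orthonormal_eigenbasis A e (l \<circ> e)"
    unfolding orthonormal_eigenbasis_def
  proof (intro conjI allI)
    fix i j
    have "e i \<in> X" "e j \<in> X"
      using e by (auto dest: bij_betwE)
    moreover have "i = j" if "e i = e j"
      using e that by (auto simp: bij_betw_def dest: injD)
    ultimately show "e i \<bullet> e j = (if i = j then 1 else 0)"
      using X by (auto simp: norm_eq_1 pairwise_def orthogonal_def)
    show "A *v e i = (l \<circ> e) i *\<^sub>R e i"
      using l \<open>e i \<in> X\<close> by simp
  qed
  then show ?thesis
    using that by blast
qed

text \<open>Orthonormality of the columns is the first equation; a left inverse of a square matrix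
  is also a right inverse, and this second equation is completeness of the basis.\<close>

lemma orthonormal_eigenbasis_matrix:
  fixes A :: "real^'n^'n::finite"
  assumes "orthonormal_eigenbasis A e \<nu>"
  defines "Q \<equiv> (\<chi> i j. e j $ i)"
  shows "transpose Q ** Q = mat 1" "Q ** transpose Q = mat 1"
    "A ** Q = Q ** (\<chi> i j. if i = j then \<nu> i else 0)"
proof -
  show *: "transpose Q ** Q = mat 1"
    using orthonormal_eigenbasisD(1)[OF assms(1)]
    by (simp add: vec_eq_iff Q_def transpose_def matrix_matrix_mult_def mat_def inner_vec_def)
  then show "Q ** transpose Q = mat 1"
    by (simp add: matrix_left_right_inverse)
  show "A ** Q = Q ** (\<chi> i j. if i = j then \<nu> i else 0)"
    using orthonormal_eigenbasisD(2)[OF assms(1)]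
    by (simp add: vec_eq_iff Q_def matrix_matrix_mult_def matrix_vector_mult_def
        if_distrib[of "\<lambda>x. _ * x"] cong: if_cong)
qed

lemma orthonormal_eigenbasis_expansion:
  fixes A :: "real^'n^'n::finite"
  assumes "orthonormal_eigenbasis A e \<nu>"
  shows "(\<Sum>i\<in>UNIV. (e i \<bullet> x) *\<^sub>R e i) = x"
proof -
  define Q where "Q = (\<chi> i j. e j $ i)"
  have "Q *v (transpose Q *v x) = x"
    using orthonormal_eigenbasis_matrix(2)[OF assms] unfolding Q_def
    by (simp add: matrix_vector_mul_assoc del: transpose_matrix_vector)
  moreover have "(transpose Q *v x) $ i = e i \<bullet> x" for i
    by (simp add: Q_def matrix_vector_mult_def transpose_def inner_vec_def
        del: transpose_matrix_vector)
  moreover have "(Q *v y) = (\<Sum>i\<in>UNIV. y $ i *\<^sub>R e i)" for y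
    by (simp add: Q_def vec_eq_iff matrix_vector_mult_def mult.commute)
  ultimately show ?thesis
    by (simp del: transpose_matrix_vector)
qed

lemma orthonormal_eigenbasis_parseval:
  fixes A :: "real^'n^'n::finite"
  assumes "orthonormal_eigenbasis A e \<nu>"
  shows "(\<Sum>i\<in>UNIV. (e i \<bullet> x)\<^sup>2) = x \<bullet> x"
proof -
  have "x \<bullet> x = x \<bullet> (\<Sum>i\<in>UNIV. (e i \<bullet> x) *\<^sub>R e i)"
    using orthonormal_eigenbasis_expansion[OF assms] by metis
  then show ?thesis
    by (simp add: inner_sum_right power2_eq_square inner_commute)
qed

text \<open>Conjugation by the orthogonal matrix \<open>Q\<close> makes \<open>mat t - A\<close>
  diagonal; the factor \<open>det Q\<close> is nonzero and cancels.\<close>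

lemma det_orthonormal_eigenbasis:
  fixes A :: "real^'n^'n::finite"
  assumes "orthonormal_eigenbasis A e \<nu>"
  shows "det (mat t - A) = (\<Prod>i\<in>UNIV. t - \<nu> i)"
proof -
  define Q where "Q = (\<chi> i j. e j $ i)"
  define L :: "real^'n^'n" where "L = (\<chi> i j. if i = j then t - \<nu> i else 0)"
  note Q = orthonormal_eigenbasis_matrix[OF assms, folded Q_def]
  have "mat t ** Q = Q ** mat t"
    by (simp add: vec_eq_iff matrix_matrix_mult_def mat_def
        if_distrib[of "\<lambda>x. _ * x"] if_distrib[of "\<lambda>x. x * _"] cong: if_cong)
  then have "(mat t - A) ** Q = Q ** (mat t - (\<chi> i j. if i = j then \<nu> i else 0))"
    using Q(3)
    by (simp add: vec_eq_iff matrix_matrix_mult_def left_diff_distrib right_diff_distrib sum_subtractf)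
  also have "mat t - (\<chi> i j. if i = j then \<nu> i else 0) = L"
    by (simp add: L_def mat_def vec_eq_iff)
  finally have "det ((mat t - A) ** Q) = det (Q ** L)"
    by simp
  moreover have "det Q \<noteq> 0"
    using Q by (metis det_I det_mul mult_zero_right zero_neq_one)
  moreover have "det L = (\<Prod>i\<in>UNIV. t - \<nu> i)"
    by (subst det_diagonal) (auto simp: L_def)
  ultimately show ?thesis
    by (simp add: det_mul)
qed

text \<open>In characteristic 0 equal polynomial functions are equal polynomials, which have equal
  multisets of roots. This matches the ordered list \<mu>, given through the characteristic
  polynomial, with the node-indexed eigenvalues \<nu>.\<close>

lemma bij_betw_if_prod_linear_factors_eq:
  fixes \<mu> :: "'a \<Rightarrow> 'c::{idom,ring_char_0}" and \<nu> :: "'b \<Rightarrow> 'c"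
  assumes fin: "finite K" "finite I" and card: "card K = card I"
    and eq: "\<And>t. (\<Prod>k\<in>K. t - \<mu> k) = (\<Prod>i\<in>I. t - \<nu> i)"
  obtains p where "bij_betw p K I" "\<And>k. k \<in> K \<Longrightarrow> \<nu> (p k) = \<mu> k"
proof -
  have roots: "proots (\<Prod>i\<in>X. [:- g i, 1:]) = image_mset g (mset_set X)"
    if "finite X" for g :: "'d \<Rightarrow> 'c" and X
    using that by (subst proots_prod) (auto simp: sum_unfold_sum_mset)
  \<comment> \<open>The index sets may have different types; \<open>h\<close> moves both root
    multisets onto \<open>K\<close>, so that the two families differ by a permutation of
    \<open>K\<close>.\<close>
  obtain h where h: "bij_betw h K I"
    using fin card by (metis finite_same_card_bij)
  have "poly (\<Prod>k\<in>K. [:- \<mu> k, 1:]) = poly (\<Prod>i\<in>I. [:- \<nu> i, 1:])"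
    using eq by (auto simp: poly_prod)
  then have "image_mset \<mu> (mset_set K) = image_mset \<nu> (mset_set I)"
    using roots fin by (metis poly_eq_poly_eq_iff)
  also have "mset_set I = image_mset h (mset_set K)"
    using h by (metis bij_betw_def image_mset_mset_set)
  finally have "image_mset \<mu> (mset_set K) = image_mset (\<nu> \<circ> h) (mset_set K)"
    by (simp add: multiset.map_comp)
  then obtain p where "p permutes K" "\<forall>k\<in>K. \<mu> k = (\<nu> \<circ> h) (p k)"
    using image_mset_eq_implies_permutes[OF fin(1)] by metis
  then show ?thesis
    using that[of "h \<circ> p"] h by (auto intro: bij_betw_trans permutes_imp_bij)
qed

text \<open>Expand a complex eigenvector in the real eigenbasis: symmetry turns
  \<open>l * c i\<close> into \<open>\<nu> i * c i\<close>, and some coefficient is nonzero.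
  Conversely each real eigenvector is also a complex one.\<close>

lemma eigenvalues_orthonormal_eigenbasis:
  fixes A :: "real^'n^'n::finite"
  assumes sym: "transpose A = A" and e: "orthonormal_eigenbasis A e \<nu>"
  shows "eigenvalues A = range (\<lambda>i. complex_of_real (\<nu> i))"
proof (intro subset_antisym subsetI)
  fix l assume "l \<in> eigenvalues A"
  then obtain v :: "complex^'n" where v: "v \<noteq> 0"
    "(\<chi> i j. complex_of_real (A $ i $ j)) *v v = l *s v"
    unfolding eigenvalues_def by auto
  have lv: "(\<Sum>j\<in>UNIV. A $ i $ j * v $ j) = l * v $ i" for i
    using v(2) by (simp add: vec_eq_iff matrix_vector_mult_def)
  define c where "c i = (\<Sum>j\<in>UNIV. e i $ j * v $ j)" for i
  have "\<exists>i. c i \<noteq> 0"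
  proof (rule ccontr)
    assume "\<not> ?thesis"
    \<comment> \<open>Since \<open>e i\<close> is real, the real and imaginary parts of
      \<open>v\<close> would each be orthogonal to a whole basis.\<close>
    then have "Re (c i) = 0" "Im (c i) = 0" for i
      by auto
    then have "e i \<bullet> (\<chi> j. Re (v $ j)) = 0" "e i \<bullet> (\<chi> j. Im (v $ j)) = 0" for i
      by (simp_all add: c_def inner_vec_def)
    then have "(\<chi> j. Re (v $ j)) = 0" "(\<chi> j. Im (v $ j)) = 0"
      using orthonormal_eigenbasis_expansion[OF e, of "\<chi> j. Re (v $ j)"]
        orthonormal_eigenbasis_expansion[OF e, of "\<chi> j. Im (v $ j)"] by simp_all
    then show False
      using v(1) by (simp add: vec_eq_iff complex_eq_iff)
  qed
  then obtain i where i: "c i \<noteq> 0" ..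
  have "A $ j $ k = A $ k $ j" for j k
    using sym by (metis transpose_def vec_lambda_beta)
  then have "(\<Sum>j\<in>UNIV. A $ j $ k * e i $ j) = (\<Sum>j\<in>UNIV. A $ k $ j * e i $ j)" for k
    by metis
  then have ev: "(\<Sum>j\<in>UNIV. A $ j $ k * e i $ j) = \<nu> i * e i $ k" for k
    using orthonormal_eigenbasisD(2)[OF e, of i] by (simp add: vec_eq_iff matrix_vector_mult_def)
  have "l * c i = (\<Sum>j\<in>UNIV. e i $ j * (\<Sum>k\<in>UNIV. A $ j $ k * v $ k))"
    unfolding lv c_def by (simp add: sum_distrib_left mult_ac)
  also have "\<dots> = (\<Sum>k\<in>UNIV. \<Sum>j\<in>UNIV. e i $ j * (A $ j $ k * v $ k))"
    unfolding sum_distrib_left by (rule sum.swap)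
  also have "\<dots> = (\<Sum>k\<in>UNIV. of_real (\<Sum>j\<in>UNIV. A $ j $ k * e i $ j) * v $ k)"
    by (simp add: sum_distrib_left mult_ac)
  also have "\<dots> = \<nu> i * c i"
    unfolding ev c_def by (simp add: sum_distrib_left mult_ac)
  finally show "l \<in> range (\<lambda>i. complex_of_real (\<nu> i))"
    using i by auto
next
  fix l assume "l \<in> range (\<lambda>i. complex_of_real (\<nu> i))"
  then obtain i where i: "l = complex_of_real (\<nu> i)"
    by auto
  define v :: "complex^'n" where "v = (\<chi> j. of_real (e i $ j))"
  have "e i \<noteq> 0"
    using orthonormal_eigenbasisD(1)[OF e, of i i] by auto
  then have "v \<noteq> 0"
    by (auto simp: v_def vec_eq_iff)
  moreover have "(\<chi> i j. complex_of_real (A $ i $ j)) *v v = l *s v"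
    using orthonormal_eigenbasisD(2)[OF e, of i]
    by (simp add: v_def i vec_eq_iff matrix_vector_mult_def flip: of_real_mult of_real_sum)
  ultimately show "l \<in> eigenvalues A"
    unfolding eigenvalues_def by auto
qed

subsection \<open>Adjacency matrices of connected regular graphs\<close>

lemma adjacency_matrix_symmetric:
  "connected_regular_graph E d \<Longrightarrow> transpose (adjacency_matrix E) = adjacency_matrix E"
  by (auto simp: connected_regular_graph_def adjacency_matrix_def transpose_def vec_eq_iff symp_def)

lemma adjacency_matrix_row_sum:
  assumes "connected_regular_graph E d"
  shows "(\<Sum>j\<in>UNIV. adjacency_matrix E $ i $ j) = real d"
  using assms by (simp add: connected_regular_graph_def adjacency_matrix_def sum.If_cases)

lemma adjacency_matrix_mult_one:
  assumes "connected_regular_graph E d"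
  shows "adjacency_matrix E *v 1 = real d *\<^sub>R 1"
  using adjacency_matrix_row_sum[OF assms]
  by (simp add: vec_eq_iff matrix_vector_mult_def)

text \<open>This is twice the quadratic form of the graph Laplacian \<open>d I - A\<close>, each
  edge being counted in both directions. On expanding the square, symmetry and constant row sums
  turn each of the two square terms into \<open>real d * (v \<bullet> v)\<close>.\<close>

lemma adjacency_matrix_dirichlet_form:
  assumes g: "connected_regular_graph E d"
  shows "(\<Sum>i\<in>UNIV. \<Sum>j\<in>UNIV. adjacency_matrix E $ i $ j * (v $ i - v $ j)\<^sup>2)
    = 2 * (real d * (v \<bullet> v) - v \<bullet> (adjacency_matrix E *v v))"
proof -
  let ?A = "adjacency_matrix E"
  have sym: "?A $ j $ i = ?A $ i $ j" for i j
    using adjacency_matrix_symmetric[OF g] by (metis transpose_def vec_lambda_beta)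
  have swap: "(\<Sum>i\<in>UNIV. \<Sum>j\<in>UNIV. ?A $ i $ j * (v $ j)\<^sup>2) = (\<Sum>i\<in>UNIV. \<Sum>j\<in>UNIV. ?A $ i $ j * (v $ i)\<^sup>2)"
    by (subst sum.swap) (intro sum.cong refl, simp add: sym)
  have diag: "(\<Sum>i\<in>UNIV. \<Sum>j\<in>UNIV. ?A $ i $ j * (v $ i)\<^sup>2) = real d * (v \<bullet> v)"
    using adjacency_matrix_row_sum[OF g]
    by (simp add: inner_vec_def power2_eq_square sum_distrib_left flip: sum_distrib_right)
  have "(\<Sum>i\<in>UNIV. \<Sum>j\<in>UNIV. ?A $ i $ j * (v $ i - v $ j)\<^sup>2)
    = (\<Sum>i\<in>UNIV. \<Sum>j\<in>UNIV. ?A $ i $ j * (v $ i)\<^sup>2) + (\<Sum>i\<in>UNIV. \<Sum>j\<in>UNIV. ?A $ i $ j * (v $ j)\<^sup>2)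
      - 2 * (\<Sum>i\<in>UNIV. \<Sum>j\<in>UNIV. v $ i * (?A $ i $ j * v $ j))"
    unfolding sum_distrib_left sum.distrib[symmetric] sum_subtractf[symmetric]
    by (intro sum.cong refl) (simp add: power2_eq_square algebra_simps)
  then show ?thesis
    unfolding swap diag by (simp add: inner_vec_def matrix_vector_mult_def sum_distrib_left)
qed

text \<open>On an eigenvector the Dirichlet form is
  \<open>2 * ((real d - m) * (v \<bullet> v))\<close>, a sum of nonnegative terms. If it vanishes,
  \<open>v\<close> is constant along edges and, by connectedness, on all nodes.\<close>

lemma adjacency_matrix_eigenvalue:
  fixes E :: "'n::finite \<Rightarrow> 'n \<Rightarrow> bool"
  assumes g: "connected_regular_graph E d"
    and v: "adjacency_matrix E *v v = m *\<^sub>R v" "v \<noteq> 0"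
  shows "m \<le> real d" and "m = real d \<Longrightarrow> v \<in> span {1}"
proof -
  let ?A = "adjacency_matrix E"
  have nonneg: "0 \<le> ?A $ i $ j * (v $ i - v $ j)\<^sup>2" for i j
    by (simp add: adjacency_matrix_def)
  have D: "(\<Sum>i\<in>UNIV. \<Sum>j\<in>UNIV. ?A $ i $ j * (v $ i - v $ j)\<^sup>2) = 2 * ((real d - m) * (v \<bullet> v))"
    unfolding adjacency_matrix_dirichlet_form[OF g] v by (simp add: algebra_simps)
  moreover have "0 \<le> (\<Sum>i\<in>UNIV. \<Sum>j\<in>UNIV. ?A $ i $ j * (v $ i - v $ j)\<^sup>2)"
    using nonneg by (intro sum_nonneg)
  ultimately show "m \<le> real d"
    using v(2) inner_gt_zero_iff[of v] by (auto simp: zero_le_mult_iff simp del: inner_gt_zero_iff)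
  assume "m = real d"
  with D have "(\<Sum>i\<in>UNIV. \<Sum>j\<in>UNIV. ?A $ i $ j * (v $ i - v $ j)\<^sup>2) = 0"
    by simp
  then have "?A $ i $ j * (v $ i - v $ j)\<^sup>2 = 0" for i j
    using nonneg by (simp add: sum_nonneg_eq_0_iff sum_nonneg)
  then have edge: "v $ i = v $ j" if "E i j" for i j
    using that by (simp add: adjacency_matrix_def) (metis mult_1 zero_neq_one)
  have "v $ i = v $ j" for i j
  proof -
    have "E\<^sup>*\<^sup>* i j"
      using g by (simp add: connected_regular_graph_def)
    then show ?thesis
      by induction (auto dest: edge)
  qed
  \<comment> \<open>Here \<open>undefined\<close> is just an arbitrary node, all entries being
    equal.\<close>
  then have "v = v $ undefined *\<^sub>R 1"
    by (simp add: vec_eq_iff)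
  then show "v \<in> span {1}"
    by (metis span_base span_scale singletonI)
qed

subsection \<open>Gaussian vectors and the Lyapunov equation\<close>

lemma normal_law_second_moment:
  assumes "0 \<le> s"
  shows "integrable (normal_law m s) (\<lambda>t. (t - m)\<^sup>2)" (is ?I)
    and "(\<integral>t. (t - m)\<^sup>2 \<partial>normal_law m s) = s" (is ?E)
proof -
  have "?I \<and> ?E"
  proof (cases "s = 0")
    case True
    then show ?thesis
      by (auto simp: normal_law_def integral_return intro!: integrableI_bounded
          simp: nn_integral_return)
  next
    case False
    with assms have s: "0 < sqrt s"
      by simp
    \<comment> \<open>The variance is the even central moment of order \<open>2 * k\<close> at
      \<open>k = 1\<close>, for standard deviation \<open>sqrt s\<close>.\<close>
    show ?thesis
      using False assms s integrable_normal_moment[OF s, of m 2] integral_normal_moment_even[OF s, of m 1]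
      by (simp add: normal_law_def integrable_density integral_density numeral_2_eq_2[symmetric] fact_numeral)
  qed
  then show ?I ?E
    by auto
qed

text \<open>Only the law of the scalar \<open>u \<bullet> z\<close> enters, so the moments transfer
  from the normal law by change of variables; degenerate directions are covered by its point-mass
  case.\<close>

lemma multivariate_normal_second_moment:
  assumes "multivariate_normal P z m C"
  shows "integrable P (\<lambda>w. (u \<bullet> z w - u \<bullet> m)\<^sup>2)"
    and "(\<integral>w. (u \<bullet> z w - u \<bullet> m)\<^sup>2 \<partial>P) = u \<bullet> (C *v u)"
proof -
  have z[measurable]: "z \<in> borel_measurable P" and s: "0 \<le> u \<bullet> (C *v u)"
    and law: "distr P borel (\<lambda>w. u \<bullet> z w) = normal_law (u \<bullet> m) (u \<bullet> (C *v u))"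
    using assms by (auto simp: multivariate_normal_def)
  show "integrable P (\<lambda>w. (u \<bullet> z w - u \<bullet> m)\<^sup>2)"
    using normal_law_second_moment(1)[OF s, of "u \<bullet> m", folded law]
    by (subst (asm) integrable_distr_eq) auto
  show "(\<integral>w. (u \<bullet> z w - u \<bullet> m)\<^sup>2 \<partial>P) = u \<bullet> (C *v u)"
    using normal_law_second_moment(2)[OF s, of "u \<bullet> m", folded law]
    by (subst (asm) integral_distr) auto
qed

section \<open>Spatial variance in an orthonormal basis\<close>

lemma spatial_var_shift: "spatial_var (a *\<^sub>R 1 + v) = spatial_var v"
  for v :: "real^'n::finite"
proof -
  have "mean_entry (a *\<^sub>R 1 + v) = a + mean_entry v"
    by (simp add: mean_entry_def sum.distrib add_divide_distrib)
  then show ?thesis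
    by (simp add: spatial_var_def)
qed

text \<open>The subtracted term is the squared length of the projection of \<open>v\<close> onto
  \<open>1\<close>, so the variance measures the part of \<open>v\<close> orthogonal to the uniform
  direction.\<close>

lemma spatial_var_alt:
  fixes v :: "real^'n::finite"
  shows "spatial_var v = (v \<bullet> v - (1 \<bullet> v)\<^sup>2 / real CARD('n)) / (real CARD('n) - 1)"
proof -
  define m where "m = mean_entry v"
  have m: "1 \<bullet> v = real CARD('n) * m"
    by (simp add: m_def mean_entry_def inner_vec_def)
  have "(\<Sum>i\<in>UNIV. (v $ i - m)\<^sup>2) = (\<Sum>i\<in>UNIV. v $ i * v $ i - 2 * m * v $ i + m * m)"
    by (intro sum.cong refl) (simp add: power2_eq_square algebra_simps)
  also have "\<dots> = v \<bullet> v - 2 * m * (1 \<bullet> v) + real CARD('n) * (m * m)"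
    by (simp add: sum.distrib sum_subtractf inner_vec_def sum_distrib_left)
  also have "\<dots> = v \<bullet> v - (1 \<bullet> v)\<^sup>2 / real CARD('n)"
    unfolding m by (simp add: power2_eq_square)
  finally show ?thesis
    by (simp add: spatial_var_def m_def)
qed

lemma norm_one_in_span_one:
  fixes v :: "real^'n::finite"
  assumes "v \<in> span {1}" "norm v = 1"
  obtains c where "v = c *\<^sub>R 1" "c\<^sup>2 * real CARD('n) = 1"
proof -
  obtain c where c: "v = c *\<^sub>R 1"
    using assms by (auto simp: span_singleton)
  have "v \<bullet> v = 1"
    using assms by (simp add: norm_eq_1)
  with c that show ?thesis
    by (simp add: inner_vec_def power2_eq_square algebra_simps)
qed

text \<open>By Parseval, removing the uniform component from \<open>v \<bullet> v\<close> deletes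
  exactly the term \<open>i0\<close>; the sign of \<open>e i0\<close> disappears in the
  square.\<close>

lemma spatial_var_orthonormal_eigenbasis:
  fixes M :: "real^'n^'n::finite"
  assumes e: "orthonormal_eigenbasis M e l" and i0: "e i0 \<in> span {1}"
  shows "spatial_var v = (\<Sum>i\<in>UNIV - {i0}. (e i \<bullet> v)\<^sup>2) / (real CARD('n) - 1)"
proof -
  have "norm (e i0) = 1"
    using orthonormal_eigenbasisD(1)[OF e, of i0 i0] by (simp add: norm_eq_1)
  then obtain c where c: "e i0 = c *\<^sub>R 1" "c\<^sup>2 * real CARD('n) = 1"
    using norm_one_in_span_one i0 by metis
  then have "(e i0 \<bullet> v)\<^sup>2 = (1 \<bullet> v)\<^sup>2 / real CARD('n)"
    by (simp add: power_mult_distrib field_simps)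
  then show ?thesis
    using orthonormal_eigenbasis_parseval[OF e, of v]
    by (simp add: spatial_var_alt sum_diff1)
qed

lemma mat_mult_vector: "mat c *v v = c *\<^sub>R v" for v :: "real^'n::finite"
  by (simp add: vec_eq_iff mat_def matrix_vector_mult_def if_distrib[of "\<lambda>x. x * _"] cong: if_cong)

text \<open>Apply the equation to \<open>e\<close> and pair with \<open>e\<close>. Symmetry of
  \<open>M\<close> lets it act on \<open>e\<close> in both terms on the left, so each gives
  \<open>l * (e \<bullet> (C *v e))\<close>.\<close>

lemma lyapunov_eigenvector:
  fixes M C :: "real^'n^'n::finite"
  assumes sym: "transpose M = M" and lyap: "M ** C + C ** transpose M = mat \<sigma> ** transpose (mat \<sigma>)"
    and e: "M *v e = l *\<^sub>R e" "e \<bullet> e = 1"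
  shows "2 * l * (e \<bullet> (C *v e)) = \<sigma>\<^sup>2"
proof -
  have "(mat \<sigma> ** transpose (mat \<sigma>)) *v e = \<sigma>\<^sup>2 *\<^sub>R e"
    by (simp add: matrix_vector_mul_assoc[symmetric] mat_mult_vector power2_eq_square
        del: transpose_matrix_vector)
  moreover have "(M ** C + C ** transpose M) *v e = M *v (C *v e) + l *\<^sub>R (C *v e)"
    using sym e by (simp add: matrix_vector_mult_add_rdistrib matrix_vector_mul_assoc[symmetric]
        matrix_vector_mult_scaleR)
  moreover have "e \<bullet> (M *v (C *v e)) = l * (e \<bullet> (C *v e))"
    using dot_lmul_matrix[of e M] sym e by (metis inner_scaleR_left transpose_matrix_vector)
  ultimately have "l * (e \<bullet> (C *v e)) + l * (e \<bullet> (C *v e)) = e \<bullet> (\<sigma>\<^sup>2 *\<^sub>R e)"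
    using lyap by (metis inner_add_right inner_scaleR_right)
  with e show ?thesis
    by simp
qed

text \<open>The expectation is taken mode by mode: \<open>e i \<bullet> z\<close> has mean 0 and, by
  the Lyapunov equation, variance \<open>\<sigma>\<^sup>2 / (2 * l i)\<close>. Only squares of modes
  occur, so no cross covariances arise.\<close>

lemma expectation_spatial_var:
  fixes M C :: "real^'n^'n::finite"
  assumes e: "orthonormal_eigenbasis M e l" and i0: "e i0 \<in> span {1}"
    and sym: "transpose M = M" and pos: "\<And>i. 0 < l i"
    and lyap: "M ** C + C ** transpose M = mat \<sigma> ** transpose (mat \<sigma>)"
    and z: "multivariate_normal P z 0 C"
  shows "integrable P (\<lambda>w. spatial_var (a *\<^sub>R 1 + z w))"
    and "(\<integral>w. spatial_var (a *\<^sub>R 1 + z w) \<partial>P)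
      = \<sigma>\<^sup>2 / (2 * (real CARD('n) - 1)) * (\<Sum>i\<in>UNIV - {i0}. 1 / l i)"
proof -
  note moment = multivariate_normal_second_moment[OF z, simplified]
  have "e i \<bullet> (C *v e i) = \<sigma>\<^sup>2 / 2 * (1 / l i)" for i
    using lyapunov_eigenvector[OF sym lyap, of "e i" "l i"] orthonormal_eigenbasisD[OF e, of i] pos[of i]
    by (simp add: field_simps)
  then have *: "(\<integral>w. (e i \<bullet> z w)\<^sup>2 \<partial>P) = \<sigma>\<^sup>2 / 2 * (1 / l i)" for i
    using moment by simp
  show "integrable P (\<lambda>w. spatial_var (a *\<^sub>R 1 + z w))"
    unfolding spatial_var_shift unfolding spatial_var_orthonormal_eigenbasis[OF e i0]
    using moment by simp
  have "(\<integral>w. spatial_var (a *\<^sub>R 1 + z w) \<partial>P)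
      = (\<Sum>i\<in>UNIV - {i0}. \<sigma>\<^sup>2 / 2 * (1 / l i)) / (real CARD('n) - 1)"
    unfolding spatial_var_shift unfolding spatial_var_orthonormal_eigenbasis[OF e i0]
    using moment * by simp
  then show "(\<integral>w. spatial_var (a *\<^sub>R 1 + z w) \<partial>P)
      = \<sigma>\<^sup>2 / (2 * (real CARD('n) - 1)) * (\<Sum>i\<in>UNIV - {i0}. 1 / l i)"
    unfolding sum_distrib_left[symmetric] by simp
qed

subsection \<open>The stability matrix\<close>

lemma has_derivative_vec_lambda:
  fixes f :: "'a::real_normed_vector \<Rightarrow> 'n::finite \<Rightarrow> real"
  assumes "\<And>i. ((\<lambda>x. f x i) has_derivative (\<lambda>h. f' h i)) (at a within S)"
  shows "((\<lambda>x. \<chi> i. f x i) has_derivative (\<lambda>h. \<chi> i. f' h i)) (at a within S)"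
  using assms by (subst has_derivative_componentwise_within) (auto simp: Basis_vec_def inner_axis)

text \<open>At a uniform state the partial derivatives of \<open>G\<close> are the same for every
  pair of nodes. The first is multiplied by the row sum \<open>d\<close> and joins \<open>f'\<close>
  in a multiple of the identity; the second multiplies the adjacency matrix.\<close>

lemma stability_matrix_network_field:
  fixes E :: "'n::finite \<Rightarrow> 'n \<Rightarrow> bool"
  assumes g: "connected_regular_graph E d"
    and f: "(\<lambda>a. f a \<alpha>) differentiable at (xst \<alpha>)"
    and G: "(\<lambda>(u\<^sub>1, u\<^sub>2). G u\<^sub>1 u\<^sub>2) differentiable at (xst \<alpha>, xst \<alpha>)"
  obtains c where
    "stability_matrix (network_field f G D (adjacency_matrix E)) (\<lambda>\<alpha>. xst \<alpha> *\<^sub>R 1) \<alpha>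
      = mat c - (D * deriv (\<lambda>u\<^sub>2. G (xst \<alpha>) u\<^sub>2) (xst \<alpha>)) *\<^sub>R adjacency_matrix E"
proof -
  let ?A = "adjacency_matrix E" and ?u = "xst \<alpha>"
  obtain f' where f': "((\<lambda>a. f a \<alpha>) has_derivative (*) f') (at ?u)"
    using f by (auto simp: real_differentiable_def has_field_derivative_def)
  obtain G' where G': "((\<lambda>(u\<^sub>1, u\<^sub>2). G u\<^sub>1 u\<^sub>2) has_derivative G') (at (?u, ?u))"
    using G by (auto simp: differentiable_def)
  define g1 g2 where "g1 = G' (1, 0)" "g2 = G' (0, 1)"
  have lin: "linear G'"
    using G' by (rule has_derivative_linear)
  have G'_eq: "G' (h, k) = h * g1 + k * g2" for h k
  proof -
    have "G' (h *\<^sub>R (1, 0) + k *\<^sub>R (0, 1)) = h * g1 + k * g2"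
      unfolding g1_g2_def linear_add[OF lin] linear_cmul[OF lin] by simp
    then show ?thesis
      by simp
  qed
  \<comment> \<open>Restricting the total derivative to the second coordinate identifies
    \<open>g2\<close> with the partial derivative given by \<open>deriv\<close>.\<close>
  have "((\<lambda>u\<^sub>2. (case (?u, u\<^sub>2) of (u\<^sub>1, u\<^sub>2) \<Rightarrow> G u\<^sub>1 u\<^sub>2)) has_derivative (\<lambda>k. G' (0, k))) (at ?u)"
    by (rule has_derivative_compose[of "\<lambda>u\<^sub>2. (?u, u\<^sub>2)" _ _ _ "\<lambda>(u\<^sub>1, u\<^sub>2). G u\<^sub>1 u\<^sub>2"])
      (auto intro!: derivative_eq_intros G')
  then have "((\<lambda>u\<^sub>2. G ?u u\<^sub>2) has_real_derivative g2) (at ?u)"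
    by (simp add: has_field_derivative_def G'_eq mult.commute[of _ g2])
  then have g2: "deriv (\<lambda>u\<^sub>2. G ?u u\<^sub>2) ?u = g2"
    by (rule DERIV_imp_deriv)
  define L :: "real^'n \<Rightarrow> real^'n" where
    "L h = (\<chi> i. f' * h $ i + D * (\<Sum>j\<in>UNIV. ?A $ i $ j * (h $ i * g1 + h $ j * g2)))" for h
  have vec_nth: "((\<lambda>x::real^'n. x $ i) has_derivative (\<lambda>h. h $ i)) net" for i net
    by (intro bounded_linear_imp_has_derivative bounded_linear_vec_nth)
  have comp: "((\<lambda>x. G (x $ i) (x $ j)) has_derivative (\<lambda>h. h $ i * g1 + h $ j * g2)) (at (?u *\<^sub>R 1))"
    for i j :: 'n
  proof -
    have "((\<lambda>x::real^'n. (case (x $ i, x $ j) of (u\<^sub>1, u\<^sub>2) \<Rightarrow> G u\<^sub>1 u\<^sub>2))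
        has_derivative (\<lambda>h. G' (h $ i, h $ j))) (at (?u *\<^sub>R 1))"
      by (rule has_derivative_compose[of "\<lambda>x. (x $ i, x $ j)" _ _ _ "\<lambda>(u\<^sub>1, u\<^sub>2). G u\<^sub>1 u\<^sub>2"])
        (use G' in \<open>auto intro!: has_derivative_Pair[OF vec_nth vec_nth]\<close>)
    then show ?thesis
      by (simp add: G'_eq)
  qed
  have compf: "((\<lambda>x::real^'n. f (x $ i) \<alpha>) has_derivative (\<lambda>h. f' * h $ i)) (at (?u *\<^sub>R 1))" for i
    by (rule has_derivative_compose[of "\<lambda>x. x $ i" _ _ _ "\<lambda>a. f a \<alpha>"])
      (auto intro!: vec_nth f')
  have "((\<lambda>x. network_field f G D ?A x \<alpha>) has_derivative L) (at (?u *\<^sub>R 1))"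
    unfolding network_field_def L_def
    by (intro has_derivative_vec_lambda has_derivative_add has_derivative_mult_right
        has_derivative_sum comp compf)
  then have jac: "jacobian (\<lambda>x. network_field f G D ?A x \<alpha>) (at (?u *\<^sub>R 1)) = matrix L"
    unfolding jacobian_def by (simp add: frechet_derivative_at[symmetric])
  have "L h = (f' + D * real d * g1) *\<^sub>R h + (D * g2) *\<^sub>R (?A *v h)" for h
  proof -
    have "(\<Sum>j\<in>UNIV. ?A $ i $ j * (h $ i * g1 + h $ j * g2))
      = (\<Sum>j\<in>UNIV. ?A $ i $ j) * (h $ i * g1) + g2 * (\<Sum>j\<in>UNIV. ?A $ i $ j * h $ j)" for i
      by (simp add: distrib_left sum.distrib sum_distrib_left sum_distrib_right mult_ac)
    then show ?thesis
      by (simp add: L_def adjacency_matrix_row_sum[OF g] vec_eq_iff matrix_vector_mult_def algebra_simps)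
  qed
  moreover have axis_entry: "(axis j 1 :: real^'n) $ i = (if i = j then 1 else 0)" for i j
    by (simp add: axis_def)
  ultimately have "matrix L = mat (f' + D * real d * g1) + (D * g2) *\<^sub>R ?A"
    using axis_entry by (simp add: matrix_def vec_eq_iff mat_def matrix_vector_mult_basis column_def)
  then have "stability_matrix (network_field f G D ?A) (\<lambda>\<alpha>. xst \<alpha> *\<^sub>R 1) \<alpha>
      = mat (- (f' + D * real d * g1)) - (D * deriv (\<lambda>u\<^sub>2. G ?u u\<^sub>2) ?u) *\<^sub>R ?A"
    by (simp add: stability_matrix_def jac g2 vec_eq_iff mat_def)
  then show ?thesis
    by (rule that)
qed

section \<open>Spectrum of a shifted adjacency matrix\<close>

lemma shifted_matrix_mult:
  fixes A :: "real^'n^'n::finite"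
  shows "(mat c - w *\<^sub>R A) *v v = c *\<^sub>R v - w *\<^sub>R (A *v v)"
  by (simp add: matrix_vector_mult_diff_rdistrib mat_mult_vector scaleR_matrix_vector_assoc)

lemma orthonormal_eigenbasis_shifted_matrix:
  assumes "orthonormal_eigenbasis A e \<nu>"
  shows "orthonormal_eigenbasis (mat c - w *\<^sub>R A) e (\<lambda>i. c - w * \<nu> i)"
  using assms by (simp add: orthonormal_eigenbasis_def shifted_matrix_mult scaleR_left_diff_distrib)

lemma transpose_shifted_matrix:
  fixes A :: "real^'n^'n::finite"
  shows "transpose A = A \<Longrightarrow> transpose (mat c - w *\<^sub>R A) = mat c - w *\<^sub>R A"
  by (simp add: transpose_def vec_eq_iff mat_def)

text \<open>Some \<open>e i\<close> is not orthogonal to \<open>1\<close>, as otherwise the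
  expansion of \<open>1\<close> would vanish. Letting the symmetric matrix act on either factor of
  \<open>e i \<bullet> 1\<close> then forces \<open>\<nu> i = real d\<close>.\<close>

lemma adjacency_matrix_degree_eigenvalue:
  assumes g: "connected_regular_graph E d" and e: "orthonormal_eigenbasis (adjacency_matrix E) e \<nu>"
  obtains i where "\<nu> i = real d"
proof -
  let ?A = "adjacency_matrix E"
  have "\<exists>i. e i \<bullet> 1 \<noteq> 0"
    using orthonormal_eigenbasis_expansion[OF e, of 1]
    by (metis (no_types, lifting) scaleR_zero_left sum.neutral zero_neq_one)
  then obtain i where "e i \<bullet> 1 \<noteq> 0" ..
  moreover have "\<nu> i * (e i \<bullet> 1) = real d * (e i \<bullet> 1)"
    using dot_lmul_matrix[of "e i" ?A 1] orthonormal_eigenbasisD(2)[OF e, of i]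
      adjacency_matrix_mult_one[OF g] adjacency_matrix_symmetric[OF g]
    by (metis inner_scaleR_left inner_scaleR_right transpose_matrix_vector)
  ultimately show ?thesis
    using that by auto
qed

text \<open>Since \<open>w > 0\<close>, the map from \<nu> to \<open>c - w * \<nu>\<close> is
  decreasing, so the smallest eigenvalue of \<open>M\<close> comes from the largest one of the
  adjacency matrix, \<open>d\<close>, with the same eigenspace.\<close>

lemma adjacency_matrix_critical:
  fixes E :: "'n::finite \<Rightarrow> 'n \<Rightarrow> bool" and c w :: real
  assumes g: "connected_regular_graph E d" and w: "0 < w"
  defines "M \<equiv> mat c - w *\<^sub>R adjacency_matrix E"
  shows "critical_eigenvalue M = c - w * real d"
    and "complex_of_real (critical_eigenvalue M) \<in> eigenvalues M"
    and "critical_eigenspace M = span {1}"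
proof -
  let ?A = "adjacency_matrix E"
  obtain e \<nu> where e: "orthonormal_eigenbasis ?A e \<nu>"
    using symmetric_matrix_eigenbasis adjacency_matrix_symmetric[OF g] by blast
  have ev: "eigenvalues M = range (\<lambda>i. complex_of_real (c - w * \<nu> i))"
    unfolding M_def
    using adjacency_matrix_symmetric[OF g] e
    by (intro eigenvalues_orthonormal_eigenbasis orthonormal_eigenbasis_shifted_matrix
        transpose_shifted_matrix)
  have e0: "e i \<noteq> 0" for i
    using orthonormal_eigenbasisD(1)[OF e, of i i] by auto
  have "\<nu> i \<le> real d" for i
    using adjacency_matrix_eigenvalue(1)[OF g orthonormal_eigenbasisD(2)[OF e] e0] .
  moreover have deg: "\<exists>i. \<nu> i = real d"
    using adjacency_matrix_degree_eigenvalue[OF g e] by metis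
  ultimately show crit: "critical_eigenvalue M = c - w * real d"
    unfolding critical_eigenvalue_def ev using w deg
    by (intro Min_eqI) (auto simp: image_iff, metis)
  show "complex_of_real (critical_eigenvalue M) \<in> eigenvalues M"
    unfolding crit ev using deg by (metis rangeI)
  have "v \<in> critical_eigenspace M \<longleftrightarrow> ?A *v v = real d *\<^sub>R v" for v
  proof -
    have "v \<in> critical_eigenspace M \<longleftrightarrow> w *\<^sub>R (?A *v v) = w *\<^sub>R (real d *\<^sub>R v)"
      by (auto simp: critical_eigenspace_def crit[unfolded M_def] M_def shifted_matrix_mult scaleR_left_diff_distrib)
    then show ?thesis
      using w by (simp del: scaleR_scaleR)
  qed
  moreover have "?A *v v = real d *\<^sub>R v \<longleftrightarrow> v \<in> span {1}" for v
    using adjacency_matrix_eigenvalue(2)[OF g, of v] adjacency_matrix_mult_one[OF g]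
    by (cases "v = 0") (auto simp: span_singleton matrix_vector_mult_scaleR)
  ultimately show "critical_eigenspace M = span {1}"
    by auto
qed

text \<open>All eigenvalues are at most \<open>d\<close> and \<open>d\<close> occurs, so it comes
  first in the list. A second occurrence would put two orthogonal unit vectors on the line spanned
  by \<open>1\<close>.\<close>

lemma adjacency_matrix_ordered_eigenvalues:
  fixes E :: "'n::finite \<Rightarrow> 'n \<Rightarrow> bool"
  assumes g: "connected_regular_graph E d" and N: "CARD('n) \<ge> 2"
    and \<mu>: "ordered_eigenvalues (adjacency_matrix E) \<mu>"
  obtains e \<nu> p where "orthonormal_eigenbasis (adjacency_matrix E) e \<nu>"
    and "bij_betw p {1..CARD('n)} UNIV" "\<And>k. k \<in> {1..CARD('n)} \<Longrightarrow> \<nu> (p k) = \<mu> k"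
    and "\<mu> 1 = real d" "\<And>k. k \<in> {2..CARD('n)} \<Longrightarrow> \<mu> k < \<mu> 1" "e (p 1) \<in> span {1}"
proof -
  let ?A = "adjacency_matrix E"
  obtain e \<nu> where e: "orthonormal_eigenbasis ?A e \<nu>"
    using symmetric_matrix_eigenbasis adjacency_matrix_symmetric[OF g] by blast
  obtain p where p: "bij_betw p {1..CARD('n)} UNIV" "\<And>k. k \<in> {1..CARD('n)} \<Longrightarrow> \<nu> (p k) = \<mu> k"
  proof (rule bij_betw_if_prod_linear_factors_eq)
    show "(\<Prod>k\<in>{1..CARD('n)}. t - \<mu> k) = (\<Prod>i\<in>UNIV. t - \<nu> i)" for t
      using \<mu> det_orthonormal_eigenbasis[OF e, of t] by (auto simp: ordered_eigenvalues_def)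
  qed auto
  have e0: "e i \<noteq> 0" for i
    using orthonormal_eigenbasisD(1)[OF e, of i i] by auto
  note ev = adjacency_matrix_eigenvalue[OF g orthonormal_eigenbasisD(2)[OF e] e0]
  obtain i where "\<nu> i = real d"
    using adjacency_matrix_degree_eigenvalue[OF g e] .
  moreover obtain k where "k \<in> {1..CARD('n)}" "p k = i"
    using p(1) by (metis UNIV_I bij_betw_imp_surj_on imageE)
  ultimately have k: "k \<in> {1..CARD('n)}" "\<mu> k = real d"
    using p(2)[of k] by auto
  have desc: "\<mu> l \<le> \<mu> k" if "k \<in> {1..CARD('n)}" "l \<in> {1..CARD('n)}" "k \<le> l" for k l
    using \<mu> that unfolding ordered_eigenvalues_def by blast
  have "\<mu> k \<le> \<mu> 1"
    using k N by (intro desc) auto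
  moreover have "\<mu> 1 \<le> real d"
    using ev(1)[of "p 1"] p(2)[of 1] N by simp
  ultimately have \<mu>1: "\<mu> 1 = real d"
    using k by simp
  have in_span: "e (p k) \<in> span {1}" if "k \<in> {1..CARD('n)}" "\<mu> k = real d" for k
    using ev(2)[of "p k"] p(2)[of k] that by simp
  have "\<mu> k < \<mu> 1" if k: "k \<in> {2..CARD('n)}" for k
  proof (rule ccontr)
    assume "\<not> \<mu> k < \<mu> 1"
    moreover have "\<mu> k \<le> \<mu> 1"
      using k N by (intro desc) auto
    ultimately have "e (p k) \<in> span {1}" "e (p 1) \<in> span {1}"
      using in_span k N \<mu>1 by auto
    then obtain a b where ab: "e (p k) = a *\<^sub>R 1" "e (p 1) = b *\<^sub>R 1"
      by (auto simp: span_singleton)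
    have "p k \<noteq> p 1"
      using inj_onD[OF bij_betw_imp_inj_on[OF p(1)], of k 1] k N by auto
    then have "e (p k) \<bullet> e (p 1) = 0"
      using orthonormal_eigenbasisD(1)[OF e] by simp
    then show False
      using e0[of "p k"] e0[of "p 1"] ab by auto
  qed
  with that[OF e p] \<mu>1 in_span[of 1] N show ?thesis
    by auto
qed

section \<open>Uniform branch, critical direction and limit of the expected variance\<close>

theorem theorem5p1:
  fixes E :: "'n::finite \<Rightarrow> 'n \<Rightarrow> bool" and d :: nat
    and f G :: "real \<Rightarrow> real \<Rightarrow> real" and D \<sigma> \<alpha>\<^sub>c \<omega>\<^sub>c :: real
    and A B :: "real^'n^'n" and F :: "real^'n \<Rightarrow> real \<Rightarrow> real^'n"
    and J :: "real set" and xst :: "real \<Rightarrow> real" and xs :: "real \<Rightarrow> real^'n"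
    and M C :: "real \<Rightarrow> real^'n^'n" and \<omega> :: "real \<Rightarrow> real" and \<mu> :: "nat \<Rightarrow> real"
    and P :: "'w measure" and z x :: "real \<Rightarrow> 'w \<Rightarrow> real^'n"
    and V :: "real \<Rightarrow> 'w \<Rightarrow> real"
  assumes N: "CARD('n) \<ge> 2"
    and graph: "connected_regular_graph E d"
    and A: "A = adjacency_matrix E"
    and F: "F = network_field f G D A"
    and B: "B = mat \<sigma>"
    and J: "J \<subseteq> {..<\<alpha>\<^sub>c}" "\<forall>\<^sub>F \<alpha> in at_left \<alpha>\<^sub>c. \<alpha> \<in> J"
    and f_smooth: "\<And>\<alpha> a. \<alpha> \<in> J \<Longrightarrow> (\<lambda>a. f a \<alpha>) differentiable at a"
    and G_smooth: "\<And>p. (\<lambda>(u\<^sub>1, u\<^sub>2). G u\<^sub>1 u\<^sub>2) differentiable at p"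
    and branch: "\<And>\<alpha>. \<alpha> \<in> J \<Longrightarrow> f (xst \<alpha>) \<alpha> + D * real d * G (xst \<alpha>) (xst \<alpha>) = 0"
    and xs: "xs = (\<lambda>\<alpha>. xst \<alpha> *\<^sub>R 1)"
    and M: "M = stability_matrix F xs"
    and stable: "\<And>\<alpha>. \<alpha> \<in> J \<Longrightarrow> asymptotically_stable (M \<alpha>)"
    and loses_stability: "((\<lambda>\<alpha>. critical_eigenvalue (M \<alpha>)) \<longlongrightarrow> 0) (at_left \<alpha>\<^sub>c)"
    and \<omega>: "\<omega> = (\<lambda>\<alpha>. D * deriv (\<lambda>u\<^sub>2. G (xst \<alpha>) u\<^sub>2) (xst \<alpha>))"
    and \<omega>_pos: "\<forall>\<^sub>F \<alpha> in at_left \<alpha>\<^sub>c. 0 < \<omega> \<alpha>"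
    and \<omega>_lim: "(\<omega> \<longlongrightarrow> \<omega>\<^sub>c) (at_left \<alpha>\<^sub>c)" "0 < \<omega>\<^sub>c"
    and \<mu>: "ordered_eigenvalues A \<mu>"
    and P: "prob_space P"
    and C: "\<And>\<alpha>. \<alpha> \<in> J \<Longrightarrow> M \<alpha> ** C \<alpha> + C \<alpha> ** transpose (M \<alpha>) = B ** transpose B"
    and z: "\<And>\<alpha>. \<alpha> \<in> J \<Longrightarrow> multivariate_normal P (z \<alpha>) 0 (C \<alpha>)"
    and x: "x = (\<lambda>\<alpha> w. xs \<alpha> + z \<alpha> w)"
    and V: "V = (\<lambda>\<alpha> w. spatial_var (x \<alpha> w))"
  shows
    \<comment> \<open>uniform equilibrium branch\<close>
    "(\<forall>\<alpha>\<in>J. F (xs \<alpha>) \<alpha> = 0 \<and> spatial_var (xs \<alpha>) = 0) \<and>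
    \<comment> \<open>critical eigenspace and eigenvector wherever \<open>\<omega> > 0\<close> on the branch\<close>
     (\<forall>\<alpha>\<in>J. 0 < \<omega> \<alpha> \<longrightarrow>
        complex_of_real (critical_eigenvalue (M \<alpha>)) \<in> eigenvalues (M \<alpha>) \<and>
        critical_eigenspace (M \<alpha>) = span {1} \<and>
        critical_unit_eigenvector (M \<alpha>) ((1 / sqrt (real CARD('n))) *\<^sub>R 1) \<and>
        (\<forall>v. critical_unit_eigenvector (M \<alpha>) v \<longrightarrow> \<rho> v = 1)) \<and>
    \<comment> \<open>limit of every choice with the orientation of \<open>1 / sqrt N\<close>\<close>
     (\<forall>v. (\<forall>\<^sub>F \<alpha> in at_left \<alpha>\<^sub>c. critical_unit_eigenvector (M \<alpha>) (v \<alpha>) \<and> 0 < 1 \<bullet> v \<alpha>) \<longrightarrow>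
        (v \<longlongrightarrow> (1 / sqrt (real CARD('n))) *\<^sub>R 1) (at_left \<alpha>\<^sub>c)) \<and>
     \<mu> 1 = real d \<and> \<mu> 2 < \<mu> 1 \<and>
    \<comment> \<open>the \<open>lam k\<close> are uniquely determined for \<open>k\<close> in \<open>{1..N}\<close>\<close>
     (\<forall>\<alpha>\<in>J. \<exists>lam::nat \<Rightarrow> real.
        (\<forall>k\<in>{1..CARD('n)}. corresponding_eigenvalue A (M \<alpha>) (\<mu> k) (lam k)) \<and>
        integrable P (V \<alpha>) \<and>
        prob_space.expectation P (V \<alpha>) =
          \<sigma>\<^sup>2 / (2 * (real CARD('n) - 1)) * (\<Sum>k=2..CARD('n). 1 / lam k)) \<and>
     ((\<lambda>\<alpha>. prob_space.expectation P (V \<alpha>)) \<longlongrightarrow>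
        \<sigma>\<^sup>2 / (2 * \<omega>\<^sub>c * (real CARD('n) - 1)) * (\<Sum>k=2..CARD('n). 1 / (\<mu> 1 - \<mu> k)))
       (at_left \<alpha>\<^sub>c)"
proof -
  let ?N = "CARD('n)" and ?w = "(1 / sqrt (real CARD('n))) *\<^sub>R (1 :: real^'n)"
  have symA: "transpose A = A"
    using adjacency_matrix_symmetric[OF graph] A by simp
  obtain e \<nu> p where e: "orthonormal_eigenbasis A e \<nu>"
    and p: "bij_betw p {1..?N} UNIV" "\<And>k. k \<in> {1..?N} \<Longrightarrow> \<nu> (p k) = \<mu> k"
    and \<mu>1: "\<mu> 1 = real d" and \<mu>_less: "\<And>k. k \<in> {2..?N} \<Longrightarrow> \<mu> k < \<mu> 1"
    and ep1: "e (p 1) \<in> span {1}"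
    using adjacency_matrix_ordered_eigenvalues[OF graph N \<mu>[unfolded A]] A by metis
  have "\<exists>c. M \<alpha> = mat c - \<omega> \<alpha> *\<^sub>R A" if "\<alpha> \<in> J" for \<alpha>
    using stability_matrix_network_field[of E d f \<alpha> xst G D, OF graph f_smooth[OF that] G_smooth]
    unfolding M xs F A \<omega> by metis
  then obtain c where M_eq: "\<And>\<alpha>. \<alpha> \<in> J \<Longrightarrow> M \<alpha> = mat (c \<alpha>) - \<omega> \<alpha> *\<^sub>R A"
    by metis
  define lam where "lam \<alpha> k = c \<alpha> - \<omega> \<alpha> * \<mu> k" for \<alpha> k
  have equilibrium: "F (xs \<alpha>) \<alpha> = 0 \<and> spatial_var (xs \<alpha>) = 0" if "\<alpha> \<in> J" for \<alpha>
  proof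
    show "F (xs \<alpha>) \<alpha> = 0"
      using branch[OF that] adjacency_matrix_row_sum[OF graph]
      by (simp add: F xs A network_field_def vec_eq_iff mult.assoc flip: sum_distrib_right)
    show "spatial_var (xs \<alpha>) = 0"
      using spatial_var_shift[of "xst \<alpha>" 0] by (simp add: xs spatial_var_def mean_entry_def)
  qed
  have w: "norm ?w = 1" "?w \<in> span {1}"
  proof -
    have "norm (1 :: real^'n) = sqrt (real ?N)"
      by (simp add: norm_eq_sqrt_inner inner_vec_def)
    then show "norm ?w = 1"
      by simp
    show "?w \<in> span {1}"
      by (intro span_scale span_base) simp
  qed
  have crit: "critical_eigenvalue (M \<alpha>) = lam \<alpha> 1"
    "complex_of_real (critical_eigenvalue (M \<alpha>)) \<in> eigenvalues (M \<alpha>)"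
    "critical_eigenspace (M \<alpha>) = span {1}" if "\<alpha> \<in> J" "0 < \<omega> \<alpha>" for \<alpha>
    using adjacency_matrix_critical[OF graph that(2), of "c \<alpha>"] M_eq[OF that(1)] A
    by (simp_all add: lam_def \<mu>1[simplified])
  \<comment> \<open>The critical eigenspace is a line, so it holds exactly two unit vectors; the
    orientation condition will select one.\<close>
  have crit_vec: "critical_unit_eigenvector (M \<alpha>) v \<longleftrightarrow> (v = ?w \<or> v = - ?w)"
    if "\<alpha> \<in> J" "0 < \<omega> \<alpha>" for \<alpha> v
  proof -
    have "v = ?w \<or> v = - ?w" if "v \<in> span {1}" "norm v = 1"
    proof -
      obtain a where a: "v = a *\<^sub>R 1" "a\<^sup>2 * real ?N = 1"
        using norm_one_in_span_one \<open>v \<in> span {1}\<close> \<open>norm v = 1\<close> by metis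
      then have "a\<^sup>2 = (1 / sqrt (real ?N))\<^sup>2"
        by (simp add: power_divide field_simps)
      then have "a = 1 / sqrt (real ?N) \<or> a = - (1 / sqrt (real ?N))"
        by (simp add: power2_eq_iff)
      with a show ?thesis
        by auto
    qed
    then show ?thesis
      using w span_neg[OF w(2)] by (auto simp: critical_unit_eigenvector_def crit(3)[OF that])
  qed
  have inner_w: "1 \<bullet> ?w = sqrt (real ?N)"
    by (simp add: inner_vec_def real_div_sqrt)
  then have \<rho>_w: "\<rho> ?w = 1" "\<rho> (- ?w) = 1"
    by (simp_all add: \<rho>_def del: inner_scaleR_right)
  have orientation: "(v \<longlongrightarrow> ?w) (at_left \<alpha>\<^sub>c)"
    if "\<forall>\<^sub>F \<alpha> in at_left \<alpha>\<^sub>c. critical_unit_eigenvector (M \<alpha>) (v \<alpha>) \<and> 0 < 1 \<bullet> v \<alpha>" for v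
  proof (rule tendsto_eventually)
    \<comment> \<open>The candidate \<open>- ?w\<close> has negative inner product with
      \<open>1\<close>, so positivity leaves only \<open>?w\<close>: the family is eventually
      constant.\<close>
    show "\<forall>\<^sub>F \<alpha> in at_left \<alpha>\<^sub>c. v \<alpha> = ?w"
      using that J(2) \<omega>_pos
    proof eventually_elim
      case (elim \<alpha>)
      moreover have "\<not> 0 < 1 \<bullet> (- ?w)"
        unfolding inner_minus_right inner_w by simp
      ultimately show ?case
        using crit_vec[of \<alpha> "v \<alpha>"] by metis
    qed
  qed
  have M_basis: "orthonormal_eigenbasis (M \<alpha>) e (\<lambda>i. c \<alpha> - \<omega> \<alpha> * \<nu> i)"
    and symM: "transpose (M \<alpha>) = M \<alpha>" if "\<alpha> \<in> J" for \<alpha>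
    unfolding M_eq[OF that] using e symA
    by (simp_all add: orthonormal_eigenbasis_shifted_matrix transpose_shifted_matrix)
  \<comment> \<open>Positivity comes from stability alone, so it holds on all of \<open>J\<close>,
    whatever the sign of \<open>\<omega> \<alpha>\<close>.\<close>
  have pos: "0 < c \<alpha> - \<omega> \<alpha> * \<nu> i" if "\<alpha> \<in> J" for \<alpha> i
    using stable[OF that] eigenvalues_orthonormal_eigenbasis[OF symM M_basis, OF that that]
    by (auto simp: asymptotically_stable_def)
  have corr: "corresponding_eigenvalue A (M \<alpha>) (\<mu> k) (lam \<alpha> k)"
    if "\<alpha> \<in> J" "k \<in> {1..?N}" for \<alpha> k
  proof -
    have "e (p k) \<noteq> 0"
      using orthonormal_eigenbasisD(1)[OF e, of "p k" "p k"] by auto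
    moreover have "A *v e (p k) = \<mu> k *\<^sub>R e (p k)"
      using orthonormal_eigenbasisD(2)[OF e, of "p k"] p(2)[OF that(2)] by simp
    ultimately show ?thesis
      unfolding corresponding_eigenvalue_def M_eq[OF that(1)] lam_def
      by (auto simp: shifted_matrix_mult scaleR_left_diff_distrib)
  qed
  \<comment> \<open>Index 1 corresponds to the node \<open>p 1\<close>, whose eigenvector is
    uniform; dropping both turns the node sum in the variance into a sum from 2.\<close>
  have p2: "bij_betw p {2..?N} (UNIV - {p 1})"
  proof -
    have "{2..?N} = {1..?N} - {1}"
      by auto
    then show ?thesis
      using p(1) N by (simp add: bij_betw_DiffI)
  qed
  have V_int: "integrable P (V \<alpha>)"
    and V_exp: "prob_space.expectation P (V \<alpha>)
      = \<sigma>\<^sup>2 / (2 * (real ?N - 1)) * (\<Sum>k=2..?N. 1 / lam \<alpha> k)" if "\<alpha> \<in> J" for \<alpha>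
  proof -
    have V_eq: "V \<alpha> = (\<lambda>w. spatial_var (xst \<alpha> *\<^sub>R 1 + z \<alpha> w))"
      by (simp add: V x xs)
    note E = expectation_spatial_var[OF M_basis[OF that] ep1 symM[OF that] pos[OF that]
        C[OF that, unfolded B] z[OF that], of "xst \<alpha>", folded V_eq]
    have "(\<Sum>i\<in>UNIV - {p 1}. 1 / (c \<alpha> - \<omega> \<alpha> * \<nu> i)) = (\<Sum>k=2..?N. 1 / lam \<alpha> k)"
      unfolding sum.reindex_bij_betw[OF p2, symmetric]
      by (intro sum.cong) (auto simp: lam_def p(2))
    with E show "integrable P (V \<alpha>)" "prob_space.expectation P (V \<alpha>)
      = \<sigma>\<^sup>2 / (2 * (real ?N - 1)) * (\<Sum>k=2..?N. 1 / lam \<alpha> k)"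
      by simp_all
  qed
  \<comment> \<open>No limit of \<open>c \<alpha>\<close> is given, so \<open>lam \<alpha> k\<close>
    is rewritten as the critical eigenvalue plus
    \<open>\<omega> \<alpha> * (\<mu> 1 - \<mu> k)\<close>, where both summands converge.\<close>
  have shifted_lim: "((\<lambda>\<alpha>. critical_eigenvalue (M \<alpha>) + \<omega> \<alpha> * (\<mu> 1 - \<mu> k)) \<longlongrightarrow> 0 + \<omega>\<^sub>c * (\<mu> 1 - \<mu> k)) (at_left \<alpha>\<^sub>c)" for k
    by (intro tendsto_intros loses_stability \<omega>_lim)
  have "\<forall>\<^sub>F \<alpha> in at_left \<alpha>\<^sub>c. critical_eigenvalue (M \<alpha>) + \<omega> \<alpha> * (\<mu> 1 - \<mu> k) = lam \<alpha> k" for k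
    using J(2) \<omega>_pos by eventually_elim (simp add: crit lam_def algebra_simps)
  then have lam_lim: "((\<lambda>\<alpha>. lam \<alpha> k) \<longlongrightarrow> \<omega>\<^sub>c * (\<mu> 1 - \<mu> k)) (at_left \<alpha>\<^sub>c)" for k
    using Lim_transform_eventually[OF shifted_lim] by simp
  \<comment> \<open>Simplicity of \<open>\<mu> 1\<close> and \<open>\<omega>\<^sub>c > 0\<close>
    keep every limiting denominator nonzero.\<close>
  have "((\<lambda>\<alpha>. \<sigma>\<^sup>2 / (2 * (real ?N - 1)) * (\<Sum>k=2..?N. 1 / lam \<alpha> k)) \<longlongrightarrow>
      \<sigma>\<^sup>2 / (2 * (real ?N - 1)) * (\<Sum>k=2..?N. 1 / (\<omega>\<^sub>c * (\<mu> 1 - \<mu> k)))) (at_left \<alpha>\<^sub>c)"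
    using \<mu>_less \<omega>_lim(2) by (intro tendsto_intros lam_lim) force
  also have "\<sigma>\<^sup>2 / (2 * (real ?N - 1)) * (\<Sum>k=2..?N. 1 / (\<omega>\<^sub>c * (\<mu> 1 - \<mu> k)))
      = \<sigma>\<^sup>2 / (2 * \<omega>\<^sub>c * (real ?N - 1)) * (\<Sum>k=2..?N. 1 / (\<mu> 1 - \<mu> k))"
  proof -
    have "(\<Sum>k=2..?N. 1 / (\<omega>\<^sub>c * (\<mu> 1 - \<mu> k))) = (\<Sum>k=2..?N. 1 / (\<mu> 1 - \<mu> k)) / \<omega>\<^sub>c"
      by (simp add: sum_divide_distrib mult.commute)
    then show ?thesis
      by (simp add: mult_ac)
  qed
  \<comment> \<open>\<open>J\<close> contains all \<alpha> sufficiently close to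
    \<open>\<alpha>\<^sub>c\<close> from the left, so the exact formula holds eventually and carries
    the limit over.\<close>
  finally have "((\<lambda>\<alpha>. prob_space.expectation P (V \<alpha>)) \<longlongrightarrow>
      \<sigma>\<^sup>2 / (2 * \<omega>\<^sub>c * (real ?N - 1)) * (\<Sum>k=2..?N. 1 / (\<mu> 1 - \<mu> k))) (at_left \<alpha>\<^sub>c)"
    by (rule Lim_transform_eventually) (use J(2) in eventually_elim, simp add: V_exp)
  moreover have "\<mu> 2 < \<mu> 1"
    using \<mu>_less[of 2] N by simp
  moreover have "critical_unit_eigenvector (M \<alpha>) ?w \<and> (\<forall>v. critical_unit_eigenvector (M \<alpha>) v \<longrightarrow> \<rho> v = 1)"
    if "\<alpha> \<in> J" "0 < \<omega> \<alpha>" for \<alpha>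
    using crit_vec[OF that] \<rho>_w by metis
  moreover have "\<exists>l::nat \<Rightarrow> real.
      (\<forall>k\<in>{1..?N}. corresponding_eigenvalue A (M \<alpha>) (\<mu> k) (l k)) \<and> integrable P (V \<alpha>) \<and>
      prob_space.expectation P (V \<alpha>) = \<sigma>\<^sup>2 / (2 * (real ?N - 1)) * (\<Sum>k=2..?N. 1 / l k)"
    if "\<alpha> \<in> J" for \<alpha>
    using corr V_int V_exp that by blast
  ultimately show ?thesis
    using equilibrium crit(2,3) orientation \<mu>1 by blast
qed

end
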